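(* Let $G$ be a Dehn-Sommerville $q$-manifold with vertex set $V(G)$, let $k\ge 1$, $A_k=\{0,1,\dots,k\}$, and let $g:V(G)\to A_k$ be an arbitrary function. Extend $g$ to $G$ by $g(x)=\{g(v): v\in x\}$ and put $G_g=\{x\in G: g(x)=A_k\}$. If $G_g$ is non-empty, then $G_g$ is a Dehn-Sommerville $(q-k)$-manifold.
   Context: A finite abstract simplicial complex $G$ is a finite set of non-empty finite sets closed under taking non-empty subsets; its vertices are its one-element sets (identified with their elements). For $x\in G$, $\omega(x)=(-1)^{|x|-1}$ and $\chi(A)=\sum_{x\in A}\omega(x)$ for $A\subset G$. The star of $x$ is $U(x)=\{y\in G: x\subset y\}$, $\overline{U(x)}=\{z\in G: z\subset y\text{ for some }y\in U(x)\}$, and the unit sphere is $S(x)=\overline{U(x)}\setminus U(x)$. The empty complex is the Dehn-Sommerville $(-1)$-sphere; for $q\ge 0$ a non-empty complex is a Dehn-Sommerville $q$-manifold if every unit sphere is a Dehn-Sommerville $(q-1)$-sphere, and a Dehn-Sommerville $q$-sphere is a Dehn-Sommerville $q$-manifold with $\chi=1+(-1)^q$. Graph version: for a finite simple graph, the unit sphere of a vertex $v$ is the subgraph induced by the neighbours of $v$; the Euler characteristic of a graph is that of its Whitney complex (the set of vertex sets of its non-empty complete subgraphs). The empty graph is the Dehn-Sommerville $(-1)$-sphere graph; for $q\ge0$ a non-empty graph is a Dehn-Sommerville $q$-manifold graph if every unit sphere is a Dehn-Sommerville $(q-1)$-sphere graph, and a Dehn-Sommerville $q$-sphere graph is a Dehn-Sommerville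 $q$-manifold graph with Euler characteristic $1+(-1)^q$. A subset $U\subset G$ (such as $G_g$, which is a union of stars) is called a Dehn-Sommerville $m$-manifold if the graph with vertex set $U$ and edges $\{x,y\}$ for distinct $x,y\in U$ with $x\subset y$ or $y\subset x$ is a Dehn-Sommerville $m$-manifold graph. *)

theory Defs
  imports Main "HOL-Library.FuncSet"
begin

definition simplicial_complex :: "'a set set \<Rightarrow> bool" where
  "simplicial_complex G \<longleftrightarrow>
     finite G \<and> (\<forall>x\<in>G. finite x \<and> x \<noteq> {}) \<and> (\<forall>x\<in>G. \<forall>y. y \<subseteq> x \<and> y \<noteq> {} \<longrightarrow> y \<in> G)"

definition vertices :: "'a set set \<Rightarrow> 'a set" where
  "vertices G = {v. {v} \<in> G}"

definition omega :: "'a set \<Rightarrow> int" where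
  "omega x = (- 1) ^ (card x - 1)"

definition euler_char :: "'a set set \<Rightarrow> int" where
  "euler_char A = (\<Sum>x\<in>A. omega x)"

definition star :: "'a set set \<Rightarrow> 'a set \<Rightarrow> 'a set set" where
  "star G x = {y \<in> G. x \<subseteq> y}"

definition star_closure :: "'a set set \<Rightarrow> 'a set \<Rightarrow> 'a set set" where
  "star_closure G x = {z \<in> G. \<exists>y \<in> star G x. z \<subseteq> y}"

definition unit_sphere :: "'a set set \<Rightarrow> 'a set \<Rightarrow> 'a set set" where
  "unit_sphere G x = star_closure G x - star G x"

text \<open>The dimension is an integer, so that the sphere of dimension \<open>-1\<close> is included.
  Manifolds exist only in dimensions \<open>q \<ge> 0\<close> and are non-empty.\<close>

inductive ds_sphere :: "int \<Rightarrow> 'a set set \<Rightarrow> bool"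
  and ds_manifold :: "int \<Rightarrow> 'a set set \<Rightarrow> bool"
where
  ds_sphere_empty: "ds_sphere (- 1) {}"
| ds_manifoldI: "\<lbrakk>0 \<le> q; simplicial_complex G; G \<noteq> {};
      \<forall>x\<in>G. ds_sphere (q - 1) (unit_sphere G x)\<rbrakk> \<Longrightarrow> ds_manifold q G"
| ds_sphereI: "\<lbrakk>ds_manifold q G; euler_char G = 1 + (- 1) ^ nat q\<rbrakk> \<Longrightarrow> ds_sphere q G"

text \<open>A graph is a pair of its vertex set and its set of edges, which are two-element sets.\<close>

type_synonym 'v graph = "'v set \<times> 'v set set"

definition simple_graph :: "'v graph \<Rightarrow> bool" where
  "simple_graph \<Gamma> \<longleftrightarrow> finite (fst \<Gamma>) \<and> (\<forall>e \<in> snd \<Gamma>. e \<subseteq> fst \<Gamma> \<and> card e = 2)"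

definition induced_subgraph :: "'v graph \<Rightarrow> 'v set \<Rightarrow> 'v graph" where
  "induced_subgraph \<Gamma> W = (W, {e \<in> snd \<Gamma>. e \<subseteq> W})"

definition neighbours :: "'v graph \<Rightarrow> 'v \<Rightarrow> 'v set" where
  "neighbours \<Gamma> v = {u \<in> fst \<Gamma>. {u, v} \<in> snd \<Gamma>}"

definition graph_unit_sphere :: "'v graph \<Rightarrow> 'v \<Rightarrow> 'v graph" where
  "graph_unit_sphere \<Gamma> v = induced_subgraph \<Gamma> (neighbours \<Gamma> v)"

definition whitney_complex :: "'v graph \<Rightarrow> 'v set set" where
  "whitney_complex \<Gamma> =
     {x. x \<noteq> {} \<and> x \<subseteq> fst \<Gamma> \<and> (\<forall>u\<in>x. \<forall>v\<in>x. u \<noteq> v \<longrightarrow> {u, v} \<in> snd \<Gamma>)}"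

definition graph_euler_char :: "'v graph \<Rightarrow> int" where
  "graph_euler_char \<Gamma> = euler_char (whitney_complex \<Gamma>)"

inductive ds_sphere_graph :: "int \<Rightarrow> 'v graph \<Rightarrow> bool"
  and ds_manifold_graph :: "int \<Rightarrow> 'v graph \<Rightarrow> bool"
where
  ds_sphere_graph_empty: "ds_sphere_graph (- 1) ({}, {})"
| ds_manifold_graphI: "\<lbrakk>0 \<le> q; simple_graph \<Gamma>; fst \<Gamma> \<noteq> {};
      \<forall>v \<in> fst \<Gamma>. ds_sphere_graph (q - 1) (graph_unit_sphere \<Gamma> v)\<rbrakk>
      \<Longrightarrow> ds_manifold_graph q \<Gamma>"
| ds_sphere_graphI: "\<lbrakk>ds_manifold_graph q \<Gamma>; graph_euler_char \<Gamma> = 1 + (- 1) ^ nat q\<rbrakk>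
      \<Longrightarrow> ds_sphere_graph q \<Gamma>"

definition inclusion_graph :: "'a set set \<Rightarrow> 'a set graph" where
  "inclusion_graph U =
     (U, {{x, y} | x y. x \<in> U \<and> y \<in> U \<and> x \<noteq> y \<and> (x \<subseteq> y \<or> y \<subseteq> x)})"

definition subset_ds_manifold :: "int \<Rightarrow> 'a set set \<Rightarrow> bool" where
  "subset_ds_manifold m U \<longleftrightarrow> ds_manifold_graph m (inclusion_graph U)"

definition level_set :: "'a set set \<Rightarrow> nat \<Rightarrow> ('a \<Rightarrow> nat) \<Rightarrow> 'a set set" where
  "level_set G k g = {x \<in> G. g ` x = {0..k}}"

lemma simplicial_complex_unit_sphere:
  assumes "simplicial_complex G"
  shows "simplicial_complex (unit_sphere G x)"
proof -
  have sub: "unit_sphere G x \<subseteq> G"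
    by (auto simp: unit_sphere_def star_closure_def)
  have "z \<in> unit_sphere G x" if "y \<in> unit_sphere G x" "z \<subseteq> y" "z \<noteq> {}" for y z
  proof -
    from that(1) obtain w where w: "y \<in> G" "w \<in> star G x" "y \<subseteq> w" "\<not> x \<subseteq> y"
      by (auto simp: unit_sphere_def star_closure_def star_def)
    have "z \<in> G"
      using assms w(1) that(2,3) unfolding simplicial_complex_def by blast
    moreover have "z \<subseteq> w" "\<not> x \<subseteq> z"
      using w that(2) by blast+
    ultimately show ?thesis
      using w(2) by (auto simp: unit_sphere_def star_closure_def star_def)
  qed
  moreover have "finite (unit_sphere G x)"
    using assms rev_finite_subset[OF _ sub] unfolding simplicial_complex_def by blast
  moreover have "\<forall>y\<in>unit_sphere G x. finite y \<and> y \<noteq> {}"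
    using assms sub unfolding simplicial_complex_def by blast
  ultimately show ?thesis
    unfolding simplicial_complex_def by blast
qed

lemma simple_graph_graph_unit_sphere:
  assumes "simple_graph \<Gamma>"
  shows "simple_graph (graph_unit_sphere \<Gamma> v)"
  using assms
  by (auto simp: simple_graph_def graph_unit_sphere_def induced_subgraph_def neighbours_def)

lemma simple_graph_inclusion_graph:
  assumes "finite U"
  shows "simple_graph (inclusion_graph U)"
  using assms by (auto simp: simple_graph_def inclusion_graph_def card_2_iff)

end

theory Submission
  imports Defs
begin

text \<open>
  In the inclusion graph of the level set \<open>G\<^sub>g\<close>, the unit sphere of \<open>x\<close> is the join of two posets:
  the proper subsets of \<open>x\<close> on which \<open>g\<close> is still onto, and all simplices of \<open>G\<close> strictly
  containing \<open>x\<close>. Joins of Dehn-Sommerville spheres are again such spheres, with dimensions adding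
  up to one less than the new dimension, so it suffices that the two factors are spheres of
  dimensions \<open>|x| - k - 2\<close> and \<open>q - |x|\<close>. This follows by induction, because the unit spheres
  of either factor are joins of a smaller factor of the same kind with an open interval of a Boolean
  lattice. The Euler characteristics come from the recursion
  \<open>r(U) = 1 - (\<Sum>p\<in>U. r(U\<^sub><\<^sub>p))\<close> for \<open>r = 1 - \<chi>\<close> (chains sorted by their greatest element),
  which reduces them to alternating sums over simplices; for the upper factor the sum is
  \<open>1 - \<chi>(link x)\<close>, and the link of \<open>x\<close> is a \<open>(q - |x|)\<close>-sphere by taking unit spheres of
  vertices repeatedly.
\<close>

section \<open>Alternating chain counts of finite families of sets\<close>

text \<open>This is 1 minus the Euler characteristic of the order complex: the empty chain
  contributes the 1. With this sign the quantity is multiplicative under joins.\<close>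

definition reduced_euler :: "'a set set \<Rightarrow> int" where
  "reduced_euler U = (\<Sum>c\<in>chains U. (- 1) ^ card c)"

abbreviation strictly_below :: "'a set set \<Rightarrow> 'a set \<Rightarrow> 'a set set" where
  "strictly_below U x \<equiv> {y \<in> U. y \<subset> x}"

abbreviation strictly_above :: "'a set set \<Rightarrow> 'a set \<Rightarrow> 'a set set" where
  "strictly_above U x \<equiv> {y \<in> U. x \<subset> y}"

lemma finite_chains: "finite U \<Longrightarrow> finite (chains U)"
  unfolding chains_def by (rule finite_subset[of _ "Pow U"]) auto

lemma chain_member_finite: "finite U \<Longrightarrow> c \<in> chains U \<Longrightarrow> finite c"
  unfolding chains_def by (auto intro: finite_subset)

lemma reduced_euler_empty [simp]: "reduced_euler {} = 1"
proof -
  have "chains {} = {{} :: 'a set set}" by (auto simp: chains_def chain_subset_def)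
  then show ?thesis by (simp add: reduced_euler_def)
qed

lemma chain_has_greatest:
  assumes "finite c" "c \<noteq> {}" "chain_subset c"
  shows "\<exists>p\<in>c. \<forall>z\<in>c. z \<subseteq> p"
proof -
  obtain p where "p \<in> c" "\<forall>z\<in>c. p \<subseteq> z \<longrightarrow> p = z"
    using finite_has_maximal[OF assms(1,2)] by blast
  then show ?thesis using assms(3) unfolding chain_subset_def by blast
qed

lemma chains_decompose_greatest:
  assumes "finite U"
  shows "chains U = insert {} (\<Union>p\<in>U. insert p ` chains (strictly_below U p))"
proof (intro equalityI subsetI)
  fix c assume c: "c \<in> chains U"
  show "c \<in> insert {} (\<Union>p\<in>U. insert p ` chains (strictly_below U p))"
  proof (cases "c = {}")
    case False
    then obtain p where p: "p \<in> c" "\<forall>z\<in>c. z \<subseteq> p"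
      using chain_has_greatest[OF chain_member_finite[OF assms c]] c
      by (auto simp: chains_def)
    have "c - {p} \<in> chains (strictly_below U p)"
      using c p unfolding chains_def chain_subset_def by auto
    moreover have "c = insert p (c - {p})" using p by auto
    moreover have "p \<in> U" using c p unfolding chains_def by auto
    ultimately show ?thesis by blast
  qed auto
next
  fix c assume "c \<in> insert {} (\<Union>p\<in>U. insert p ` chains (strictly_below U p))"
  then show "c \<in> chains U"
    unfolding chains_def chain_subset_def by auto
qed

lemma reduced_euler_recursion:
  assumes "finite U"
  shows "reduced_euler U = 1 - (\<Sum>p\<in>U. reduced_euler (strictly_below U p))"
proof -
  let ?C = "\<lambda>p. insert p ` chains (strictly_below U p)"
  have fin: "finite (?C p)" for p
    using finite_chains[of "strictly_below U p"] assms by simp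
  \<comment> \<open>If p and p' differ and one chain lies in both fibres, then each of p and p' is
    strictly below the other.\<close>
  have disj: "?C p \<inter> ?C p' = {}" if "p \<noteq> p'" for p p'
  proof (rule ccontr)
    assume "\<not> ?thesis"
    then obtain c c' where "c \<in> chains (strictly_below U p)" "c' \<in> chains (strictly_below U p')" "insert p c = insert p' c'"
      by blast
    then show False using that unfolding chains_def by blast
  qed
  have fibre_sum: "(\<Sum>c\<in>?C p. (- 1) ^ card c) = - reduced_euler (strictly_below U p)" for p
  proof -
    have "inj_on (insert p) (chains (strictly_below U p))"
      unfolding inj_on_def chains_def by blast
    then have "(\<Sum>c\<in>?C p. (- 1) ^ card c) = (\<Sum>c\<in>chains (strictly_below U p). (- 1 :: int) ^ card (insert p c))"
      by (simp add: sum.reindex)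
    also have "\<dots> = (\<Sum>c\<in>chains (strictly_below U p). - ((- 1) ^ card c))"
    proof (rule sum.cong[OF refl])
      fix c assume c: "c \<in> chains (strictly_below U p)"
      then have "finite c" "p \<notin> c"
        using chain_member_finite[OF _ c] assms by (auto simp: chains_def)
      then show "(- 1 :: int) ^ card (insert p c) = - ((- 1) ^ card c)" by simp
    qed
    finally show ?thesis by (simp add: reduced_euler_def sum_negf)
  qed
  have "reduced_euler U = 1 + (\<Sum>c\<in>(\<Union>p\<in>U. ?C p). (- 1) ^ card c)"
    unfolding reduced_euler_def chains_decompose_greatest[OF assms]
    using assms fin by (subst sum.insert) auto
  also have "(\<Sum>c\<in>(\<Union>p\<in>U. ?C p). (- 1) ^ card c) = (\<Sum>p\<in>U. \<Sum>c\<in>?C p. (- 1 :: int) ^ card c)"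
    using assms fin disj by (intro sum.UNION_disjoint) auto
  finally show ?thesis by (simp add: fibre_sum sum_negf)
qed

text \<open>Below a point of \<open>U\<close> the join looks like \<open>U\<close> alone; below a
  point p of \<open>V\<close> it is the join of \<open>U\<close> with the smaller family
  \<open>strictly_below V p\<close>. Hence the recursion factors by induction on
  \<open>card V\<close>.\<close>

lemma reduced_euler_join:
  assumes "finite U" "finite V" "\<And>u v. u \<in> U \<Longrightarrow> v \<in> V \<Longrightarrow> u \<subset> v"
  shows "reduced_euler (U \<union> V) = reduced_euler U * reduced_euler V"
  using assms(2,3)
proof (induction "card V" arbitrary: V rule: less_induct)
  case less
  have U: "strictly_below (U \<union> V) p = strictly_below U p" if "p \<in> U" for p
    using less.prems(2) that by blast
  have V: "reduced_euler (strictly_below (U \<union> V) p) = reduced_euler U * reduced_euler (strictly_below V p)"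
    if p: "p \<in> V" for p
  proof -
    have "strictly_below (U \<union> V) p = U \<union> strictly_below V p" using less.prems(2) p by blast
    moreover have "card (strictly_below V p) < card V"
      using p less.prems(1) by (intro psubset_card_mono) auto
    ultimately show ?thesis using less.hyps[of "strictly_below V p"] less.prems by auto
  qed
  have disj: "U \<inter> V = {}" using less.prems(2) by blast
  have "reduced_euler (U \<union> V) =
      1 - ((\<Sum>p\<in>U. reduced_euler (strictly_below U p)) + (\<Sum>p\<in>V. reduced_euler U * reduced_euler (strictly_below V p)))"
    using assms(1) less.prems(1) disj
    by (simp add: reduced_euler_recursion[of "U \<union> V"] sum.union_disjoint U V del: Un_iff cong: sum.cong)
  also have "\<dots> = reduced_euler U * (1 - (\<Sum>p\<in>V. reduced_euler (strictly_below V p)))"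
    using reduced_euler_recursion[OF assms(1)] by (simp add: sum_distrib_left algebra_simps)
  finally show ?case using reduced_euler_recursion[OF less.prems(1)] by simp
qed

section \<open>Inclusion graphs, and Dehn-Sommerville spheres among families of sets\<close>

lemma edge_inclusion_graph_iff:
  "{x, y} \<in> snd (inclusion_graph U) \<longleftrightarrow> x \<in> U \<and> y \<in> U \<and> x \<noteq> y \<and> (x \<subseteq> y \<or> y \<subseteq> x)"
  unfolding inclusion_graph_def snd_conv mem_Collect_eq doubleton_eq_iff by metis

lemma fst_inclusion_graph [simp]: "fst (inclusion_graph U) = U"
  by (simp add: inclusion_graph_def)

text \<open>The complete subgraphs of an inclusion graph are exactly the non-empty chains.\<close>

lemma graph_euler_char_inclusion_graph:
  assumes "finite U"
  shows "graph_euler_char (inclusion_graph U) = 1 - reduced_euler U"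
proof -
  have W: "whitney_complex (inclusion_graph U) = chains U - {{}}"
  proof (rule set_eqI)
    fix c
    have "(\<forall>u\<in>c. \<forall>v\<in>c. u \<noteq> v \<longrightarrow> {u, v} \<in> snd (inclusion_graph U)) \<longleftrightarrow> chain_subset c"
      if "c \<subseteq> U"
      using that unfolding edge_inclusion_graph_iff chain_subset_def by blast
    then show "c \<in> whitney_complex (inclusion_graph U) \<longleftrightarrow> c \<in> chains U - {{}}"
      unfolding whitney_complex_def chains_def by auto
  qed
  \<comment> \<open>The exponent in \<open>omega\<close> is a truncated subtraction, so the sign
    flip requires positive cardinality.\<close>
  have "omega c = - ((- 1) ^ card c)" if "c \<in> chains U - {{}}" for c
  proof -
    have "card c > 0" using chain_member_finite[OF assms] that by (auto simp: card_gt_0_iff)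
    then show ?thesis by (cases "card c") (auto simp: omega_def)
  qed
  then have "graph_euler_char (inclusion_graph U) = - (\<Sum>c\<in>chains U - {{}}. (- 1) ^ card c)"
    by (simp add: graph_euler_char_def euler_char_def W sum_negf)
  moreover have "{} \<in> chains U" by (auto simp: chains_def chain_subset_def)
  ultimately show ?thesis
    unfolding reduced_euler_def using finite_chains[OF assms]
    by (simp add: sum_diff1)
qed

text \<open>Unit spheres of inclusion graphs are again inclusion graphs, so the recursive definition
  of manifold graphs can be followed on families of sets alone.\<close>

lemma graph_unit_sphere_inclusion_graph:
  assumes "x \<in> U"
  shows "graph_unit_sphere (inclusion_graph U) x = inclusion_graph (strictly_below U x \<union> strictly_above U x)"
proof -
  have "neighbours (inclusion_graph U) x = strictly_below U x \<union> strictly_above U x"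
    using assms unfolding neighbours_def edge_inclusion_graph_iff by auto
  moreover have "{e \<in> snd (inclusion_graph U). e \<subseteq> W} = snd (inclusion_graph W)" if "W \<subseteq> U" for W
  proof (rule set_eqI)
    fix e
    show "e \<in> {e \<in> snd (inclusion_graph U). e \<subseteq> W} \<longleftrightarrow> e \<in> snd (inclusion_graph W)"
    \<comment> \<open>The edge criterion speaks of doubletons only; any other \<open>e\<close> is an
      edge of neither graph.\<close>
    proof (cases "\<exists>a b. e = {a, b}")
      case True
      then obtain a b where e: "e = {a, b}" by blast
      show ?thesis
        unfolding e mem_Collect_eq edge_inclusion_graph_iff insert_subset using that by blast
    next
      case False
      then have "e \<notin> snd (inclusion_graph V)" for V
        unfolding inclusion_graph_def snd_conv mem_Collect_eq by blast
      then show ?thesis by simp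
    qed
  qed
  moreover have "strictly_below U x \<union> strictly_above U x \<subseteq> U" by blast
  ultimately show ?thesis
    unfolding graph_unit_sphere_def induced_subgraph_def
    by (simp only: prod_eq_iff fst_conv snd_conv fst_inclusion_graph)
qed

text \<open>The index \<open>n\<close> is the dimension plus one, so that it is additive under joins.\<close>

definition poset_sphere :: "nat \<Rightarrow> 'a set set \<Rightarrow> bool" where
  "poset_sphere n U \<longleftrightarrow> finite U \<and> ds_sphere_graph (int n - 1) (inclusion_graph U)"

lemma poset_sphere_0 [simp]: "poset_sphere 0 {}"
  by (auto simp: poset_sphere_def inclusion_graph_def intro: ds_sphere_graph_empty)

text \<open>Index \<open>n\<close> means dimension n - 1, so unit spheres of index \<open>n\<close>
  bound the neighbourhoods of an n-dimensional manifold.\<close>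

lemma poset_manifoldI:
  assumes "finite U" "U \<noteq> {}"
    and "\<And>x. x \<in> U \<Longrightarrow> poset_sphere n (strictly_below U x \<union> strictly_above U x)"
  shows "subset_ds_manifold (int n) U"
  unfolding subset_ds_manifold_def
proof (rule ds_manifold_graphI)
  show "fst (inclusion_graph U) \<noteq> {}" using assms by (simp add: inclusion_graph_def)
  show "\<forall>v\<in>fst (inclusion_graph U). ds_sphere_graph (int n - 1) (graph_unit_sphere (inclusion_graph U) v)"
  proof
    fix v assume "v \<in> fst (inclusion_graph U)"
    then have "v \<in> U" by (simp add: inclusion_graph_def)
    then show "ds_sphere_graph (int n - 1) (graph_unit_sphere (inclusion_graph U) v)"
      using assms(3) by (simp add: graph_unit_sphere_inclusion_graph poset_sphere_def)
  qed
qed (use assms simple_graph_inclusion_graph in auto)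

lemma poset_sphere_SucI:
  assumes "finite U" "U \<noteq> {}" "reduced_euler U = (- 1) ^ Suc n"
    and "\<And>x. x \<in> U \<Longrightarrow> poset_sphere n (strictly_below U x \<union> strictly_above U x)"
  shows "poset_sphere (Suc n) U"
  unfolding poset_sphere_def
  using poset_manifoldI[OF assms(1,2,4)] assms(1,3)
  by (auto simp: subset_ds_manifold_def graph_euler_char_inclusion_graph intro!: ds_sphere_graphI)

lemma poset_sphere_finite: "poset_sphere n U \<Longrightarrow> finite U"
  by (simp add: poset_sphere_def)

text \<open>Index 0 is dimension -1, and manifolds have dimension at least 0, which leaves only the
  empty sphere.\<close>

lemma poset_sphere_0_iff [simp]: "poset_sphere 0 U \<longleftrightarrow> U = {}"
proof
  assume "poset_sphere 0 U"
  then have "ds_sphere_graph (- 1) (inclusion_graph U)" by (simp add: poset_sphere_def)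
  then show "U = {}"
    by (cases rule: ds_sphere_graph.cases)
      (auto simp: inclusion_graph_def elim: ds_manifold_graph.cases)
qed simp

lemma poset_sphere_SucD:
  assumes "poset_sphere (Suc n) U"
  shows "U \<noteq> {}" "reduced_euler U = (- 1) ^ Suc n"
    and "x \<in> U \<Longrightarrow> poset_sphere n (strictly_below U x \<union> strictly_above U x)"
proof -
  have fin: "finite U" and s: "ds_sphere_graph (int n) (inclusion_graph U)"
    using assms by (auto simp: poset_sphere_def)
  from s have m: "ds_manifold_graph (int n) (inclusion_graph U)"
    and e: "graph_euler_char (inclusion_graph U) = 1 + (- 1) ^ n"
    by (auto elim: ds_sphere_graph.cases)
  show "reduced_euler U = (- 1) ^ Suc n"
    using e by (simp add: graph_euler_char_inclusion_graph[OF fin])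
  from m show "U \<noteq> {}"
    by cases (auto simp: inclusion_graph_def)
  assume x: "x \<in> U"
  from m have "ds_sphere_graph (int n - 1) (graph_unit_sphere (inclusion_graph U) x)"
    using x by cases (auto simp: inclusion_graph_def)
  then show "poset_sphere n (strictly_below U x \<union> strictly_above U x)"
    using fin x by (simp add: poset_sphere_def graph_unit_sphere_inclusion_graph)
qed

lemma poset_sphere_reduced_euler:
  "poset_sphere n U \<Longrightarrow> reduced_euler U = (- 1) ^ n"
  by (cases n) (auto dest: poset_sphere_SucD)

section \<open>Joins of spheres\<close>

text \<open>The unit sphere of a point in a join replaces the factor containing the point by its
  unit sphere there and keeps the other factor whole. The total index drops by one, which drives the
  induction.\<close>

lemma poset_sphere_join:
  assumes "poset_sphere m U" "poset_sphere n V" "\<And>u v. u \<in> U \<Longrightarrow> v \<in> V \<Longrightarrow> u \<subset> v"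
  shows "poset_sphere (m + n) (U \<union> V)"
  using assms
proof (induction "m + n" arbitrary: m n U V)
  case 0
  then show ?case by simp
next
  case (Suc l)
  note fin = Suc.prems(1,2)[THEN poset_sphere_finite]
  have "poset_sphere (Suc l) (U \<union> V)"
  proof (rule poset_sphere_SucI)
    show "finite (U \<union> V)" using fin by simp
    show "U \<union> V \<noteq> {}"
      using Suc.hyps(2) Suc.prems(1,2) poset_sphere_SucD(1) by (cases m; cases n) auto
    show "reduced_euler (U \<union> V) = (- 1) ^ Suc l"
      using reduced_euler_join[OF fin Suc.prems(3)] Suc.prems(1,2) Suc.hyps(2)
      by (simp add: poset_sphere_reduced_euler power_add)
  next
    fix x assume "x \<in> U \<union> V"
    then show "poset_sphere l (strictly_below (U \<union> V) x \<union> strictly_above (U \<union> V) x)"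
    proof
      assume x: "x \<in> U"
      then obtain m' where m: "m = Suc m'" using Suc.prems(1) by (cases m) auto
      have "strictly_below (U \<union> V) x \<union> strictly_above (U \<union> V) x = (strictly_below U x \<union> strictly_above U x) \<union> V"
        using x Suc.prems(3) by blast
      moreover have "poset_sphere (m' + n) ((strictly_below U x \<union> strictly_above U x) \<union> V)"
      proof (rule Suc.hyps(1))
        show "poset_sphere m' (strictly_below U x \<union> strictly_above U x)"
          using poset_sphere_SucD(3) Suc.prems(1) m x by blast
      qed (use Suc.hyps(2) Suc.prems m in auto)
      ultimately show ?thesis using m Suc.hyps(2) by simp
    next
      assume x: "x \<in> V"
      then obtain n' where n: "n = Suc n'" using Suc.prems(2) by (cases n) auto
      have "strictly_below (U \<union> V) x \<union> strictly_above (U \<union> V) x = U \<union> (strictly_below V x \<union> strictly_above V x)"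
        using x Suc.prems(3) by blast
      moreover have "poset_sphere (m + n') (U \<union> (strictly_below V x \<union> strictly_above V x))"
      proof (rule Suc.hyps(1))
        show "poset_sphere n' (strictly_below V x \<union> strictly_above V x)"
          using poset_sphere_SucD(3) Suc.prems(2) n x by blast
      qed (use Suc.hyps(2) Suc.prems n in auto)
      ultimately show ?thesis using n Suc.hyps(2) by simp
    qed
  qed
  then show ?case using Suc.hyps(2) by simp
qed

section \<open>Alternating sums over subsets with prescribed image\<close>

text \<open>Induction on \<open>x\<close>, adding a point v. If \<open>g v\<close> is in
  \<open>B\<close>, a subset containing v arises from one without v whose image is \<open>B\<close>
  or \<open>B - {g v}\<close>. The former kind cancels against the subsets avoiding v, so only the
  sum for \<open>B - {g v}\<close> survives, with opposite sign.\<close>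

lemma alternating_sum_surjective_subsets:
  assumes "finite x" "B \<subseteq> g ` x"
  shows "(\<Sum>y | y \<subseteq> x \<and> g ` y = B. (- 1 :: int) ^ card y) = (- 1) ^ card B"
  using assms
proof (induction x arbitrary: B rule: finite_induct)
  case empty
  then have "{y. y \<subseteq> {} \<and> g ` y = B} = {{}}" by auto
  then show ?case using empty by simp
next
  case (insert v x)
  let ?T = "\<lambda>B. {y. y \<subseteq> x \<and> g ` y = B}"
  have fin: "finite (?T B)" for B using insert.hyps by simp
  show ?case
  proof (cases "g v \<in> B")
    case False
    have "{y. y \<subseteq> insert v x \<and> g ` y = B} = ?T B" using False by auto
    moreover have "B \<subseteq> g ` x" using insert.prems False by auto
    ultimately show ?thesis using insert.IH by simp
  next
    case True
    let ?D = "?T B \<union> ?T (B - {g v})"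
    have into: "y \<in> ?T B \<union> insert v ` ?D" if y: "y \<subseteq> insert v x" "g ` y = B" for y
    proof (cases "v \<in> y")
      case True
      have "g ` y = insert (g v) (g ` (y - {v}))" using True by auto
      then have "g ` (y - {v}) = B \<or> g ` (y - {v}) = B - {g v}"
        using y by (cases "g v \<in> g ` (y - {v})") (auto simp: insert_absorb)
      moreover have "y - {v} \<subseteq> x" using y by auto
      ultimately have "y - {v} \<in> ?D" by simp
      moreover have "y = insert v (y - {v})" using True by auto
      ultimately show ?thesis by blast
    qed (use y in auto)
    have outof: "y \<subseteq> insert v x \<and> g ` y = B" if "y \<in> ?T B \<union> insert v ` ?D" for y
      using that True by auto
    have eq: "{y. y \<subseteq> insert v x \<and> g ` y = B} = ?T B \<union> insert v ` ?D"
      by (intro equalityI subsetI CollectI; (elim CollectE conjE)?; rule into outof; assumption)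
    have "inj_on (insert v) ?D"
    proof (rule inj_onI)
      fix y z assume "y \<in> ?D" "z \<in> ?D" "insert v y = insert v z"
      moreover from this have "v \<notin> y" "v \<notin> z" using insert.hyps(2) by auto
      ultimately show "y = z" using insert_ident by metis
    qed
    then have "(\<Sum>y\<in>insert v ` ?D. (- 1 :: int) ^ card y) = (\<Sum>y\<in>?D. (- 1) ^ card (insert v y))"
      by (simp add: sum.reindex)
    also have "\<dots> = (\<Sum>y\<in>?D. - ((- 1) ^ card y))"
    proof (rule sum.cong[OF refl])
      fix y assume "y \<in> ?D"
      then have "finite y" "v \<notin> y" using insert.hyps by (auto intro: finite_subset)
      then show "(- 1 :: int) ^ card (insert v y) = - ((- 1) ^ card y)" by simp
    qed
    also have "\<dots> = - (\<Sum>y\<in>?T B. (- 1) ^ card y) - (\<Sum>y\<in>?T (B - {g v}). (- 1) ^ card y)"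
      using fin True by (subst sum.union_disjoint) (auto simp: sum_negf)
    \<comment> \<open>The induction hypothesis is applied to \<open>B - {g v}\<close> only:
      \<open>B\<close> itself may fail to lie in the image of \<open>x\<close>, but its two sums
      cancel.\<close>
    also have "(\<Sum>y\<in>?T (B - {g v}). (- 1 :: int) ^ card y) = (- 1) ^ card (B - {g v})"
      using insert.prems by (intro insert.IH) auto
    finally have "(\<Sum>y | y \<subseteq> insert v x \<and> g ` y = B. (- 1 :: int) ^ card y) = - ((- 1) ^ card (B - {g v}))"
      unfolding eq using fin insert.hyps by (subst sum.union_disjoint) auto
    moreover have "card B = Suc (card (B - {g v}))"
      using True insert.prems insert.hyps
      by (metis card.remove finite.insertI finite_imageI finite_subset)
    ultimately show ?thesis by simp
  qed
qed

section \<open>Open intervals of a Boolean lattice\<close>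

definition open_interval :: "'a set \<Rightarrow> 'a set \<Rightarrow> 'a set set" where
  "open_interval x y = {z. x \<subset> z \<and> z \<subset> y}"

lemma finite_open_interval: "finite y \<Longrightarrow> finite (open_interval x y)"
  unfolding open_interval_def by (rule finite_subset[of _ "Pow y"]) auto

lemma alternating_sum_open_interval:
  assumes "finite y" "x \<subset> y"
  shows "(\<Sum>z\<in>open_interval x y. (- 1 :: int) ^ card (z - x)) = - 1 - (- 1) ^ card (y - x)"
proof -
  let ?P = "{w. w \<subseteq> y - x \<and> w \<noteq> {}}"
  \<comment> \<open>Removing \<open>x\<close> identifies the interval with the non-empty proper
    subsets of \<open>y - x\<close>.\<close>
  have "bij_betw (\<lambda>w. x \<union> w) (?P - {y - x}) (open_interval x y)"
    unfolding open_interval_def using assms(2)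
    by (intro bij_betwI[where g = "\<lambda>z. z - x"]) auto
  then have "(\<Sum>z\<in>open_interval x y. (- 1 :: int) ^ card (z - x))
      = (\<Sum>w\<in>?P - {y - x}. (- 1) ^ card ((x \<union> w) - x))"
    by (rule sum.reindex_bij_betw[symmetric])
  also have "\<dots> = (\<Sum>w\<in>?P - {y - x}. (- 1) ^ card w)"
    by (intro sum.cong refl arg_cong2[where f = power] arg_cong[where f = card]) auto
  also have "\<dots> = (\<Sum>w\<in>?P. (- 1) ^ card w) - (- 1) ^ card (y - x)"
    using assms by (subst sum_diff1) auto
  \<comment> \<open>Non-emptiness is surjectivity of the constant map onto a point, so the previous
    sum formula applies with a one-element image.\<close>
  also have "?P = {w. w \<subseteq> y - x \<and> (\<lambda>_. ()) ` w = {()}}" by auto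
  also have "(\<Sum>w\<in>\<dots>. (- 1 :: int) ^ card w) = (- 1) ^ card {()}"
    using assms by (intro alternating_sum_surjective_subsets) auto
  finally show ?thesis by simp
qed

lemma reduced_euler_open_interval:
  assumes "finite y" "x \<subset> y"
  shows "reduced_euler (open_interval x y) = - ((- 1) ^ card (y - x))"
  using assms
proof (induction y rule: finite_psubset_induct)
  case (psubset y)
  have "reduced_euler (strictly_below (open_interval x y) z) = - ((- 1) ^ card (z - x))"
    if "z \<in> open_interval x y" for z
  proof -
    have "strictly_below (open_interval x y) z = open_interval x z"
      using that unfolding open_interval_def by auto
    then show ?thesis using psubset.IH that unfolding open_interval_def by auto
  qed
  then have "reduced_euler (open_interval x y) = 1 + (\<Sum>z\<in>open_interval x y. (- 1) ^ card (z - x))"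
    using psubset.hyps by (subst reduced_euler_recursion) (auto simp: finite_open_interval sum_negf)
  then show ?case using psubset alternating_sum_open_interval[of y x] by simp
qed

text \<open>The interval is the face poset of the boundary of the simplex on \<open>y - x\<close>,
  of dimension \<open>card (y - x)\<close> minus 2. The unit sphere of z is the join of the two
  shorter intervals from \<open>x\<close> to z and from z to \<open>y\<close>.\<close>

lemma poset_sphere_open_interval:
  assumes "finite y" "x \<subset> y"
  shows "poset_sphere (card (y - x) - 1) (open_interval x y)"
  using assms
proof (induction "card (y - x)" arbitrary: x y rule: less_induct)
  case less
  have pos: "card (y - x) > 0" using less.prems by (auto simp: card_gt_0_iff)
  show ?case
  proof (cases "card (y - x) - 1")
    case 0
    then have "card (y - x) = 1" using pos by simp
    then obtain v where "y - x = {v}" by (rule card_1_singletonE)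
    then have "y = insert v x" using less.prems by auto
    then have "open_interval x y = {}" unfolding open_interval_def by auto
    then show ?thesis using 0 by simp
  next
    case (Suc n)
    have "poset_sphere (Suc n) (open_interval x y)"
    proof (rule poset_sphere_SucI)
      show "finite (open_interval x y)" using less.prems finite_open_interval by blast
      show "reduced_euler (open_interval x y) = (- 1) ^ Suc n"
        using reduced_euler_open_interval[OF less.prems] Suc pos by (cases "card (y - x)") auto
      obtain v where v: "v \<in> y - x" using less.prems by auto
      have "y - x \<noteq> {v}" using Suc by auto
      then have "insert v x \<in> open_interval x y"
        using v less.prems unfolding open_interval_def by auto
      then show "open_interval x y \<noteq> {}" by blast
    next
      fix z assume "z \<in> open_interval x y"
      then have z: "x \<subset> z" "z \<subset> y" by (auto simp: open_interval_def)
      have fz: "finite z" using z less.prems finite_subset by blast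
      have split: "card (y - x) = card (z - x) + card (y - z)"
      proof -
        have "y - x = (z - x) \<union> (y - z)" "(z - x) \<inter> (y - z) = {}" using z by auto
        then show ?thesis using card_Un_disjoint[of "z - x" "y - z"] fz less.prems by simp
      qed
      have pos': "card (z - x) > 0" "card (y - z) > 0"
        using z fz less.prems by (auto simp: card_gt_0_iff)
      have eq: "strictly_below (open_interval x y) z \<union> strictly_above (open_interval x y) z
          = open_interval x z \<union> open_interval z y"
        using z unfolding open_interval_def by auto
      have "poset_sphere ((card (z - x) - 1) + (card (y - z) - 1)) (open_interval x z \<union> open_interval z y)"
        using less.hyps[of z x] less.hyps[of y z] z fz less.prems(1) split pos'
        by (intro poset_sphere_join) (auto simp: open_interval_def)
      moreover have "(card (z - x) - 1) + (card (y - z) - 1) = n"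
        using split Suc pos' by simp
      ultimately show "poset_sphere n (strictly_below (open_interval x y) z \<union> strictly_above (open_interval x y) z)"
        by (simp only: eq)
    qed
    then show ?thesis by (simp only: Suc)
  qed
qed

section \<open>The lower factor: smaller sets with the same image\<close>

text \<open>The comparison is with the image of \<open>x\<close> rather than a fixed set, so that
  the part strictly below a member y is the same construction for y.\<close>

definition proper_surjective_subsets :: "('a \<Rightarrow> 'b) \<Rightarrow> 'a set \<Rightarrow> 'a set set" where
  "proper_surjective_subsets g x = {y. y \<subset> x \<and> g ` y = g ` x}"

lemma finite_proper_surjective_subsets: "finite x \<Longrightarrow> finite (proper_surjective_subsets g x)"
  unfolding proper_surjective_subsets_def by (rule finite_subset[of _ "Pow x"]) auto

text \<open>All members share the image of \<open>x\<close>, so induction turns the recursion into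
  the alternating sum over subsets with that image, without the term of \<open>x\<close> itself.
  With b the sign of the image's cardinality, the claim is 1 - b (b - s) = b s, where s is the sign
  of \<open>card x\<close>.\<close>

lemma reduced_euler_proper_surjective_subsets:
  assumes "finite x"
  shows "reduced_euler (proper_surjective_subsets g x) = (- 1) ^ (card x + card (g ` x))"
  using assms
proof (induction x rule: finite_psubset_induct)
  case (psubset x)
  let ?L = "proper_surjective_subsets g x"
  have "reduced_euler (strictly_below ?L y) = (- 1) ^ card (g ` x) * (- 1) ^ card y" if "y \<in> ?L" for y
  proof -
    have "strictly_below ?L y = proper_surjective_subsets g y"
      using that unfolding proper_surjective_subsets_def by auto
    then show ?thesis
      using psubset.IH[of y] that
      by (simp add: proper_surjective_subsets_def power_add)
  qed
  then have "reduced_euler ?L = 1 - (- 1) ^ card (g ` x) * (\<Sum>y\<in>?L. (- 1) ^ card y)"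
    using psubset.hyps
    by (subst reduced_euler_recursion)
      (auto simp: finite_proper_surjective_subsets sum_distrib_left)
  moreover have "(\<Sum>y\<in>?L. (- 1 :: int) ^ card y) = (- 1) ^ card (g ` x) - (- 1) ^ card x"
  proof -
    have "?L = {y. y \<subseteq> x \<and> g ` y = g ` x} - {x}"
      unfolding proper_surjective_subsets_def by auto
    then show ?thesis
      using psubset.hyps alternating_sum_surjective_subsets[of x "g ` x" g]
      by (simp add: sum_diff1)
  qed
  ultimately show ?case
    by (simp add: algebra_simps power_add flip: power_mult_distrib)
qed

text \<open>The index counts how far \<open>g\<close> is from injective on \<open>x\<close>. The
  unit sphere of y joins the same construction for y with the interval from y to
  \<open>x\<close>.\<close>

lemma poset_sphere_proper_surjective_subsets:
  assumes "finite x"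
  shows "poset_sphere (card x - card (g ` x)) (proper_surjective_subsets g x)"
  using assms
proof (induction x rule: finite_psubset_induct)
  case (psubset x)
  let ?L = "proper_surjective_subsets g x"
  have le: "card (g ` y) \<le> card y" if "y \<subseteq> x" for y
    using that psubset.hyps card_image_le finite_subset by blast
  show ?case
  proof (cases "card x - card (g ` x)")
    case 0
    have "?L = {}"
    proof (rule ccontr)
      assume "?L \<noteq> {}"
      then obtain y where y: "y \<subset> x" "g ` y = g ` x"
        unfolding proper_surjective_subsets_def by auto
      then show False
        using 0 le[of y] psubset_card_mono[OF psubset.hyps y(1)] by auto
    qed
    then show ?thesis using 0 by simp
  next
    case (Suc n)
    have "poset_sphere (Suc n) ?L"
    proof (rule poset_sphere_SucI)
      show "finite ?L" using psubset.hyps finite_proper_surjective_subsets by blast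
      have "card x + card (g ` x) = Suc n + 2 * card (g ` x)" using Suc by simp
      then show "reduced_euler ?L = (- 1) ^ Suc n"
        using reduced_euler_proper_surjective_subsets[OF psubset.hyps, of g]
        by (simp add: power_add power_mult)
      have "\<not> inj_on g x" using Suc card_image by fastforce
      then obtain u v where "u \<in> x" "v \<in> x" "u \<noteq> v" "g u = g v" by (auto simp: inj_on_def)
      then have "u \<in> x - {v}" "x - {v} \<subset> x" "g ` x = insert (g u) (g ` (x - {v}))"
        by auto
      moreover from this(1) have "g u \<in> g ` (x - {v})" by (rule imageI)
      ultimately have "x - {v} \<in> ?L" by (simp add: proper_surjective_subsets_def insert_absorb)
      then show "?L \<noteq> {}" by blast
    next
      fix y assume "y \<in> ?L"
      then have y: "y \<subset> x" "g ` y = g ` x" by (auto simp: proper_surjective_subsets_def)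
      have fy: "finite y" using y psubset.hyps finite_subset by blast
      have eq: "strictly_below ?L y \<union> strictly_above ?L y = proper_surjective_subsets g y \<union> open_interval y x"
        using y unfolding proper_surjective_subsets_def open_interval_def by blast
      have "poset_sphere ((card y - card (g ` y)) + (card (x - y) - 1))
          (proper_surjective_subsets g y \<union> open_interval y x)"
        using psubset.IH[OF y(1)] poset_sphere_open_interval[OF psubset.hyps y(1)]
        by (rule poset_sphere_join) (auto simp: proper_surjective_subsets_def open_interval_def)
      moreover have "(card y - card (g ` y)) + (card (x - y) - 1) = n"
        using Suc le[of y] y card_Diff_subset[OF fy, of x] psubset_card_mono[OF psubset.hyps y(1)]
        by auto
      ultimately show "poset_sphere n (strictly_below ?L y \<union> strictly_above ?L y)" by (simp only: eq)
    qed
    then show ?thesis by (simp only: Suc)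
  qed
qed

section \<open>Links and the upper factor\<close>

text \<open>For a simplex with at least two vertices the unit sphere also contains its proper faces,
  so it differs from the link; the two agree at vertices.\<close>

definition link :: "'a set set \<Rightarrow> 'a set \<Rightarrow> 'a set set" where
  "link G x = {z. z \<noteq> {} \<and> z \<inter> x = {} \<and> z \<union> x \<in> G}"

lemma simplicial_complexD:
  assumes "simplicial_complex G"
  shows simplicial_complex_finite: "finite G" "x \<in> G \<Longrightarrow> finite x"
    and simplicial_complex_nonempty: "x \<in> G \<Longrightarrow> x \<noteq> {}"
    and simplicial_complex_subset: "x \<in> G \<Longrightarrow> y \<subseteq> x \<Longrightarrow> y \<noteq> {} \<Longrightarrow> y \<in> G"
  using assms unfolding simplicial_complex_def by blast+

lemma strictly_below_strictly_above:
  assumes "simplicial_complex G" "y \<in> G"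
  shows "strictly_below (strictly_above G x) y = open_interval x y"
proof -
  have "z \<in> G" if "x \<subset> z" "z \<subset> y" for z
    using that by (intro simplicial_complex_subset[OF assms(1,2)]) auto
  then show ?thesis unfolding open_interval_def by blast
qed

lemma unit_sphere_vertex:
  assumes "simplicial_complex G"
  shows "unit_sphere G {v} = link G {v}"
proof (intro equalityI subsetI)
  fix z assume "z \<in> unit_sphere G {v}"
  then obtain y where z: "z \<in> G" "y \<in> G" "v \<in> y" "z \<subseteq> y" "v \<notin> z"
    by (auto simp: unit_sphere_def star_closure_def star_def)
  then have "z \<union> {v} \<in> G" "z \<noteq> {}"
    using simplicial_complex_subset[OF assms z(2)] simplicial_complex_nonempty[OF assms] by auto
  then show "z \<in> link G {v}" using z by (auto simp: link_def)
next
  fix z assume z: "z \<in> link G {v}"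
  then have "z \<in> G" using simplicial_complex_subset[OF assms] unfolding link_def by blast
  then show "z \<in> unit_sphere G {v}"
    using z unfolding unit_sphere_def star_closure_def star_def link_def by blast
qed

lemma ds_manifoldD:
  assumes "ds_manifold q G"
  shows "0 \<le> q" "simplicial_complex G" "G \<noteq> {}"
    and "x \<in> G \<Longrightarrow> ds_sphere (q - 1) (unit_sphere G x)"
  using assms by (auto elim: ds_manifold.cases)

lemma ds_sphere_imp_ds_manifold: "ds_sphere q G \<Longrightarrow> G \<noteq> {} \<Longrightarrow> ds_manifold q G"
  by (auto elim: ds_sphere.cases)

text \<open>Splitting off a vertex v, the link of \<open>x\<close> is the link of
  \<open>x - {v}\<close> inside the link of v, which is the unit sphere of v; each vertex costs one
  dimension.\<close>

lemma ds_sphere_link: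
  assumes "ds_manifold q G" "x \<in> G"
  shows "ds_sphere (q - int (card x)) (link G x)"
  using assms
proof (induction "card x" arbitrary: q G x)
  case 0
  then show ?case
    using simplicial_complex_finite(2) simplicial_complex_nonempty ds_manifoldD(2) card_0_eq by metis
next
  case (Suc n)
  note G = ds_manifoldD(2)[OF Suc.prems(1)]
  obtain v x' where x: "x = insert v x'" "v \<notin> x'" "card x' = n"
    using Suc.hyps(2) by (metis card_Suc_eq)
  have "{v} \<in> G" using simplicial_complex_subset[OF G Suc.prems(2)] x by simp
  then have L: "ds_sphere (q - 1) (link G {v})"
    using ds_manifoldD(4)[OF Suc.prems(1)] unit_sphere_vertex[OF G] by metis
  show ?case
  proof (cases "x' = {}")
    case True
    then show ?thesis using L x by simp
  next
    case False
    then have x': "x' \<in> link G {v}" using Suc.prems(2) x by (auto simp: link_def)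
    \<comment> \<open>The sphere is non-empty because it contains \<open>x'\<close>, so it is a
      manifold and the induction hypothesis applies.\<close>
    then have "ds_manifold (q - 1) (link G {v})"
      using L ds_sphere_imp_ds_manifold by blast
    then have "ds_sphere (q - 1 - int (card x')) (link (link G {v}) x')"
      using Suc.hyps(1) x(3) x' by blast
    moreover have "link (link G {v}) x' = link G x"
      using x unfolding link_def by auto
    moreover have "q - 1 - int (card x') = q - int (card x)"
      using x Suc.hyps(2) by simp
    ultimately show ?thesis by simp
  qed
qed

text \<open>The exponent \<open>nat (q + 1)\<close> makes one Euler formula cover the empty sphere
  too, with value 0.\<close>

lemma ds_sphere_dimension:
  assumes "ds_sphere q G"
  shows "q \<ge> - 1" "G = {} \<longleftrightarrow> q = - 1" "euler_char G = 1 - (- 1) ^ nat (q + 1)"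
proof -
  have "q \<ge> - 1 \<and> (G = {} \<longleftrightarrow> q = - 1) \<and> euler_char G = 1 - (- 1) ^ nat (q + 1)"
    using assms
  proof cases
    case ds_sphere_empty
    then show ?thesis by (simp add: euler_char_def)
  next
    case ds_sphereI
    then show ?thesis
      using ds_manifoldD(1,3)[of q G] by (auto simp: nat_add_distrib)
  qed
  then show "q \<ge> - 1" "G = {} \<longleftrightarrow> q = - 1" "euler_char G = 1 - (- 1) ^ nat (q + 1)"
    by auto
qed

lemma link_bij_above: "bij_betw (\<lambda>z. z \<union> x) (link G x) (strictly_above G x)"
proof (rule bij_betwI[where g = "\<lambda>y. y - x"])
  show "(\<lambda>z. z \<union> x) \<in> link G x \<rightarrow> strictly_above G x"
    unfolding link_def by blast
  show "(\<lambda>y. y - x) \<in> strictly_above G x \<rightarrow> link G x"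
  proof
    fix y assume "y \<in> strictly_above G x"
    moreover from this have "y - x \<union> x = y" by blast
    ultimately show "y - x \<in> link G x" by (auto simp: link_def)
  qed
qed (auto simp: link_def)

text \<open>The part of the upper set below y is the interval from \<open>x\<close> to y, whose
  value is \<open>omega (y - x)\<close>; the sets \<open>y - x\<close> are the simplices of the
  link.\<close>

lemma reduced_euler_above:
  assumes "simplicial_complex G"
  shows "reduced_euler (strictly_above G x) = 1 - euler_char (link G x)"
proof -
  note fin = simplicial_complex_finite[OF assms]
  have "reduced_euler (strictly_below (strictly_above G x) y) = omega (y - x)" if y: "y \<in> strictly_above G x" for y
  proof -
    have "strictly_below (strictly_above G x) y = open_interval x y"
      using y by (intro strictly_below_strictly_above assms) auto
    moreover have "card (y - x) > 0" using y fin by (auto simp: card_gt_0_iff)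
    ultimately show ?thesis
      using y fin reduced_euler_open_interval[of y x]
      by (cases "card (y - x)") (auto simp: omega_def)
  qed
  then have "reduced_euler (strictly_above G x) = 1 - (\<Sum>y\<in>strictly_above G x. omega (y - x))"
    using fin by (subst reduced_euler_recursion) auto
  also have "(\<Sum>y\<in>strictly_above G x. omega (y - x)) = (\<Sum>z\<in>link G x. omega (z \<union> x - x))"
    by (rule sum.reindex_bij_betw[OF link_bij_above, symmetric])
  also have "\<dots> = euler_char (link G x)"
    unfolding euler_char_def
    by (intro sum.cong refl arg_cong[where f = omega]) (auto simp: link_def)
  finally show ?thesis .
qed

text \<open>The unit sphere of y joins the interval from \<open>x\<close> to y with the upper set of
  y, which has smaller index since y is larger.\<close>

lemma poset_sphere_above:
  assumes "ds_manifold q G" "x \<in> G"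
  shows "poset_sphere (nat (q + 1 - int (card x))) (strictly_above G x)"
  using assms(2)
proof (induction "nat (q + 1 - int (card x))" arbitrary: x rule: less_induct)
  case less
  note G = ds_manifoldD(2)[OF assms(1)]
  note fin = simplicial_complex_finite[OF G]
  \<comment> \<open>The link of a simplex has dimension at least -1; this bound keeps
    \<open>nat\<close> from truncating.\<close>
  have dim: "int (card y) \<le> q + 1" if "y \<in> G" for y
    using ds_sphere_dimension(1)[OF ds_sphere_link[OF assms(1) that]] by simp
  note dims = ds_sphere_dimension(2,3)[OF ds_sphere_link[OF assms(1) less.prems]]
  have empty: "strictly_above G x = {} \<longleftrightarrow> link G x = {}"
    by (simp only: bij_betw_imp_surj_on[OF link_bij_above, symmetric] image_is_empty)
  show ?case
  proof (cases "nat (q + 1 - int (card x))")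
    case 0
    then have "strictly_above G x = {}" using dim[OF less.prems] dims(1) empty by linarith
    then show ?thesis using 0 by simp
  next
    case (Suc n)
    have "poset_sphere (Suc n) (strictly_above G x)"
    proof (rule poset_sphere_SucI)
      show "finite (strictly_above G x)" using fin by simp
      show "strictly_above G x \<noteq> {}" using Suc dims(1) empty by linarith
      show "reduced_euler (strictly_above G x) = (- 1) ^ Suc n"
        using reduced_euler_above[OF G, of x] dims(2) Suc
        by (simp add: algebra_simps)
    next
      fix y assume "y \<in> strictly_above G x"
      then have y: "y \<in> G" "x \<subset> y" by auto
      have eq: "strictly_below (strictly_above G x) y \<union> strictly_above (strictly_above G x) y = open_interval x y \<union> strictly_above G y"
        using strictly_below_strictly_above[OF G y(1)] y by auto
      have less_card: "card x < card y" using psubset_card_mono y fin by blast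
      have cd: "card (y - x) = card y - card x"
        using y fin less.prems by (intro card_Diff_subset) auto
      have "poset_sphere ((card (y - x) - 1) + nat (q + 1 - int (card y))) (open_interval x y \<union> strictly_above G y)"
      proof (rule poset_sphere_join)
        show "poset_sphere (card (y - x) - 1) (open_interval x y)"
          using y fin by (intro poset_sphere_open_interval) auto
        show "poset_sphere (nat (q + 1 - int (card y))) (strictly_above G y)"
          using less_card dim[OF y(1)] by (intro less.hyps y(1)) simp
      qed (auto simp: open_interval_def)
      moreover have "(card (y - x) - 1) + nat (q + 1 - int (card y)) = n"
        using cd less_card dim[OF y(1)] Suc by linarith
      ultimately show "poset_sphere n (strictly_below (strictly_above G x) y \<union> strictly_above (strictly_above G x) y)"
        by (simp only: eq)
    qed
    then show ?thesis by (simp only: Suc)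
  qed
qed

section \<open>Assembling both factors in the level set\<close>

theorem mainTheorem2:
  fixes G :: "'a set set" and q :: int and k :: nat and g :: "'a \<Rightarrow> nat"
  assumes "ds_manifold q G"
    and "k \<ge> 1"
    and "g \<in> vertices G \<rightarrow> {0..k}"
    and "level_set G k g \<noteq> {}"
  shows "subset_ds_manifold (q - int k) (level_set G k g)"
proof -
  note G = ds_manifoldD(2)[OF assms(1)]
  note fin = simplicial_complex_finite[OF G]
  \<comment> \<open>The lower bound comes from hitting all k + 1 values, the upper one from the
    dimension of the link. Together they make the subtractions below exact and give
    \<open>q - int k \<ge> 0\<close>.\<close>
  have dim: "int k + 1 \<le> int (card x)" "int (card x) \<le> q + 1" if x: "x \<in> level_set G k g" for x
  proof -
    have "x \<in> G" "g ` x = {0..k}" using x by (auto simp: level_set_def)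
    then have "card {0..k} \<le> card x" using card_image_le fin(2) by metis
    then show "int k + 1 \<le> int (card x)" by simp
    show "int (card x) \<le> q + 1"
      using ds_sphere_dimension(1)[OF ds_sphere_link[OF assms(1) \<open>x \<in> G\<close>]] by simp
  qed
  let ?n = "nat (q - int k)"
  have "subset_ds_manifold (int ?n) (level_set G k g)"
  proof (rule poset_manifoldI)
    show "finite (level_set G k g)" using fin by (simp add: level_set_def)
    fix x assume x: "x \<in> level_set G k g"
    then have xG: "x \<in> G" and gx: "g ` x = {0..k}" by (auto simp: level_set_def)
    \<comment> \<open>The hypothesis on \<open>g\<close> concerns vertices; downward closure makes
      every point of a simplex a vertex.\<close>
    have range: "g ` y \<subseteq> {0..k}" if "y \<in> G" for y
    proof
      fix a assume "a \<in> g ` y"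
      then obtain v where "v \<in> y" "a = g v" by blast
      moreover have "{v} \<in> G" using simplicial_complex_subset[OF G that] \<open>v \<in> y\<close> by simp
      ultimately show "a \<in> {0..k}" using assms(3) by (auto simp: vertices_def)
    qed
    have "strictly_below (level_set G k g) x = proper_surjective_subsets g x"
    proof -
      have "y \<in> G" if "y \<subset> x" "g ` y = {0..k}" for y
      proof -
        have "y \<noteq> {}" using that by auto
        then show ?thesis using that simplicial_complex_subset[OF G xG] by blast
      qed
      then show ?thesis
        using gx unfolding level_set_def proper_surjective_subsets_def by auto
    qed
    \<comment> \<open>A simplex containing \<open>x\<close> already attains all values and can
      attain no others.\<close>
    moreover have "strictly_above (level_set G k g) x = strictly_above G x"
    proof -
      have "g ` y = {0..k}" if "y \<in> G" "x \<subset> y" for y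
        using range[OF that(1)] image_mono[of x y g] that(2) gx by auto
      then show ?thesis unfolding level_set_def by auto
    qed
    moreover have "poset_sphere ((card x - card (g ` x)) + nat (q + 1 - int (card x)))
        (proper_surjective_subsets g x \<union> strictly_above G x)"
      using poset_sphere_proper_surjective_subsets[OF fin(2)[OF xG]] poset_sphere_above[OF assms(1) xG]
      by (rule poset_sphere_join) (auto simp: proper_surjective_subsets_def)
    \<comment> \<open>Since the image of \<open>x\<close> has k + 1 elements, the cardinality of
      \<open>x\<close> cancels and q - k remains.\<close>
    moreover have "(card x - card (g ` x)) + nat (q + 1 - int (card x)) = ?n"
      using dim[OF x] gx by simp
    ultimately show "poset_sphere ?n (strictly_below (level_set G k g) x \<union> strictly_above (level_set G k g) x)"
      by simp
  qed (fact assms(4))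
  moreover have "q - int k \<ge> 0" using dim assms(4) by force
  ultimately show ?thesis by simp
qed

end
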